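(* Let $r\ge 1$ and let $m_1,\dots,m_r$ be integers with $m_i\ge 2$ for every $1\le i\le r$. Then for every integer $k\ge1$, $$ch_k(K_{m_1,\ldots,m_r})\le 948\, r\left(k+\log\frac{m_1+\cdots+m_r}{r}\right).$$
   Context: $K_{m_1,\ldots,m_r}$ denotes the complete $r$-partite graph with $m_i$ vertices in the $i$th vertex class. A graph $G=(V,E)$ is $(a:b)$-choosable if for every family of sets $\{S(v):v\in V\}$ with $|S(v)|=a$ for all $v$, there are subsets $C(v)\subseteq S(v)$ with $|C(v)|=b$ for all $v$ and $C(u)\cap C(v)=\emptyset$ for every two adjacent $u,v$. The $k$th choice number $ch_k(G)$ is the minimum $n$ such that $G$ is $(n:k)$-choosable. *)

theory Defs
  imports Complex_Main
begin

text \<open>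
  A graph is a pair of a vertex set and a set of two-element vertex sets.
\<close>

type_synonym 'v graph = "'v set \<times> 'v set set"

abbreviation verts :: "'v graph \<Rightarrow> 'v set" where
  "verts G \<equiv> fst G"

abbreviation edges :: "'v graph \<Rightarrow> 'v set set" where
  "edges G \<equiv> snd G"

text \<open>
  Colours are natural numbers. For the finite graphs considered here this is no
  restriction: only finitely many colours occur in a family of finite lists, so any
  colour set can be renamed injectively. The explicit finiteness is only needed for
  \<open>a = 0\<close>, because infinite sets have cardinality \<open>0\<close>.
\<close>

definition choosable :: "'v graph \<Rightarrow> nat \<Rightarrow> nat \<Rightarrow> bool" where
  "choosable G a b \<longleftrightarrow>
    (\<forall>S :: 'v \<Rightarrow> nat set.
      (\<forall>v \<in> verts G. finite (S v) \<and> card (S v) = a) \<longrightarrow>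
      (\<exists>C :: 'v \<Rightarrow> nat set.
        (\<forall>v \<in> verts G. C v \<subseteq> S v \<and> card (C v) = b) \<and>
        (\<forall>u \<in> verts G. \<forall>v \<in> verts G. {u, v} \<in> edges G \<longrightarrow> C u \<inter> C v = {})))"

definition choice_number :: "nat \<Rightarrow> 'v graph \<Rightarrow> nat" where
  "choice_number k G = (LEAST n. choosable G n k)"

text \<open>
  The \<open>i\<close>th vertex class, \<open>1 \<le> i \<le> r\<close>, consists of the pairs \<open>(i, j)\<close> with \<open>j < m i\<close>.
\<close>

definition complete_multipartite :: "nat \<Rightarrow> (nat \<Rightarrow> nat) \<Rightarrow> (nat \<times> nat) graph" where
  "complete_multipartite r m =
    (let V = (SIGMA i : {1..r}. {..<m i})
     in (V, {{u, v} | u v. u \<in> V \<and> v \<in> V \<and> fst u \<noteq> fst v}))"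

end

theory Submission
  imports Defs
begin

text \<open>
  Give the class \<open>V\<^sub>i\<close> the weight \<open>L\<^sub>i = k + ln |V\<^sub>i|\<close> and let \<open>W\<close> be the total weight. Every colour is
  reserved with probability \<open>1/2\<close> and given to the class \<open>V\<^sub>i\<close> with probability \<open>L\<^sub>i/(2W)\<close>. If all
  lists have at least \<open>100 W\<close> colours, then with positive probability every list keeps \<open>25 W\<close>
  reserved colours, while the classes in which some vertex receives fewer than \<open>k\<close> colours have
  total weight below \<open>W/4\<close>. By induction these classes can be coloured from the reserved colours.
  Finally \<open>W \<le> r (k + ln ((m\<^sub>1 + \<dots> + m\<^sub>r)/r))\<close> by concavity of the logarithm.
\<close>

section \<open>Random labellings\<close>

lemma exists_le_weighted_sum:
  fixes p h :: "'l \<Rightarrow> real"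
  assumes "finite \<Lambda>" "\<And>l. l \<in> \<Lambda> \<Longrightarrow> 0 \<le> p l" "(\<Sum>l\<in>\<Lambda>. p l) = 1"
  shows "\<exists>l\<in>\<Lambda>. h l \<le> (\<Sum>l\<in>\<Lambda>. p l * h l)"
proof -
  have ne: "\<Lambda> \<noteq> {}" using assms(3) by auto
  have "Min (h ` \<Lambda>) \<in> h ` \<Lambda>" using ne assms(1) by (intro Min_in) auto
  then obtain l where l: "l \<in> \<Lambda>" "h l = Min (h ` \<Lambda>)" by auto
  have "h l = (\<Sum>x\<in>\<Lambda>. p x * h l)" using assms(3) by (simp add: sum_distrib_right[symmetric])
  also have "\<dots> \<le> (\<Sum>x\<in>\<Lambda>. p x * h x)"
    using assms l by (intro sum_mono mult_left_mono) auto
  finally show ?thesis using l by blast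
qed

text \<open>The right-hand side is the expectation of the left-hand side when each \<open>f c\<close> is drawn
  independently with distribution \<open>p\<close>; induction on \<open>U\<close> is the method of conditional expectations.\<close>

lemma exists_labelling_le_expectation:
  fixes p :: "'l \<Rightarrow> real" and w :: "'j \<Rightarrow> real" and g :: "'j \<Rightarrow> 'l \<Rightarrow> real" and T :: "'j \<Rightarrow> 'c set"
  assumes "finite U" "finite \<Lambda>" "\<And>l. l \<in> \<Lambda> \<Longrightarrow> 0 \<le> p l" "(\<Sum>l\<in>\<Lambda>. p l) = 1"
    and "\<And>j. j \<in> J \<Longrightarrow> T j \<subseteq> U"
  shows "\<exists>f. (\<Sum>j\<in>J. w j * (\<Prod>c\<in>T j. g j (f c)))
            \<le> (\<Sum>j\<in>J. w j * (\<Sum>l\<in>\<Lambda>. p l * g j l) ^ card (T j))"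
  using assms(1,5)
proof (induction U arbitrary: T w rule: finite_induct)
  case empty
  \<comment> \<open>Here every \<open>T j\<close> is empty, so both sides equal the sum of
    \<open>w\<close> over \<open>J\<close>, or both are the default value for infinite
    \<open>J\<close>; any \<open>f\<close> serves.\<close>
  then show ?case by (intro exI[of _ undefined]) (auto intro!: sum_mono)
next
  case (insert c U)
  define q where "q j = (\<Sum>l\<in>\<Lambda>. p l * g j l)" for j
  define T' where "T' j = T j - {c}" for j
  \<comment> \<open>Once \<open>c\<close> receives the label \<open>l\<close>, its factor
    \<open>g j l\<close> is a constant and moves into the weight of every \<open>j\<close> with
    \<open>c\<close> in \<open>T j\<close>. This is why the induction must generalise over
    \<open>w\<close> as well as over \<open>T\<close>.\<close>
  define w' where "w' l j = w j * (if c \<in> T j then g j l else 1)" for l j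
  define h where "h l = (\<Sum>j\<in>J. w' l j * q j ^ card (T' j))" for l
  have fin: "finite (T j)" if "j \<in> J" for j
    using insert.prems[OF that] insert.hyps(1) by (meson finite.insertI finite_subset)
  \<comment> \<open>Averaging over the label of \<open>c\<close> puts the missing factor
    \<open>q j\<close> back, so the conditional expectations \<open>h l\<close> average to the full
    expectation and some \<open>l\<close> does not exceed it.\<close>
  have avg: "(\<Sum>l\<in>\<Lambda>. p l * w' l j) * q j ^ card (T' j) = w j * q j ^ card (T j)"
    if "j \<in> J" for j
  proof (cases "c \<in> T j")
    case True
    have "(\<Sum>l\<in>\<Lambda>. p l * w' l j) = w j * q j"
      using True by (simp add: w'_def q_def sum_distrib_left mult_ac)
    moreover have "card (T j) = Suc (card (T' j))"
      unfolding T'_def using True fin[OF that] by (simp only: card.remove)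
    ultimately show ?thesis by simp
  next
    case False
    then show ?thesis
      using assms(4) by (simp add: w'_def T'_def sum_distrib_right[symmetric])
  qed
  obtain l where l: "h l \<le> (\<Sum>l\<in>\<Lambda>. p l * h l)"
    using exists_le_weighted_sum[OF assms(2-4), of h] by blast
  have "(\<Sum>l\<in>\<Lambda>. p l * h l) = (\<Sum>j\<in>J. (\<Sum>l\<in>\<Lambda>. p l * w' l j) * q j ^ card (T' j))"
    unfolding h_def sum_distrib_left sum_distrib_right
    by (subst sum.swap) (simp add: mult_ac)
  also have "\<dots> = (\<Sum>j\<in>J. w j * q j ^ card (T j))"
    by (intro sum.cong refl avg)
  finally have hl: "h l \<le> (\<Sum>j\<in>J. w j * q j ^ card (T j))" using l by simp
  obtain f where f: "(\<Sum>j\<in>J. w' l j * (\<Prod>x\<in>T' j. g j (f x))) \<le> h l"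
    using insert.IH[of T' "w' l"] insert.prems unfolding h_def q_def T'_def by blast
  have "w j * (\<Prod>x\<in>T j. g j ((f(c := l)) x)) = w' l j * (\<Prod>x\<in>T' j. g j (f x))"
    if "j \<in> J" for j
  proof (cases "c \<in> T j")
    case True
    have "(\<Prod>x\<in>T j. g j ((f(c := l)) x))
        = g j l * (\<Prod>x\<in>T j - {c}. g j ((f(c := l)) x))"
      using prod.remove[OF fin[OF that] True, of "\<lambda>x. g j ((f(c := l)) x)"] by simp
    also have "(\<Prod>x\<in>T j - {c}. g j ((f(c := l)) x)) = (\<Prod>x\<in>T' j. g j (f x))"
      unfolding T'_def by (intro prod.cong) auto
    finally show ?thesis using True by (simp add: w'_def)
  next
    case False
    then have "(\<Prod>x\<in>T j. g j ((f(c := l)) x)) = (\<Prod>x\<in>T' j. g j (f x))"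
      unfolding T'_def by (intro prod.cong) auto
    then show ?thesis using False by (simp add: w'_def)
  qed
  then have "(\<Sum>j\<in>J. w j * (\<Prod>x\<in>T j. g j ((f(c := l)) x))) \<le> (\<Sum>j\<in>J. w j * q j ^ card (T j))"
    using f hl by (simp cong: sum.cong)
  then show ?case unfolding q_def by blast
qed

text \<open>An exponential-moment bound for the lower tail. The power of 1/2 is a product over
  \<open>T j\<close> with factor 1/2 at each hit of the target label \<open>t j\<close> and 1
  elsewhere; the mean factor is \<open>1 - p (t j) / 2\<close>, which is at most
  \<open>exp (- p (t j) / 2)\<close>. A weight such as \<open>2 ^ k\<close> in \<open>w j\<close>
  then detects indices with at most \<open>k\<close> hits.\<close>

lemma exists_labelling_few_hits_bound:
  fixes p :: "'l \<Rightarrow> real" and w :: "'j \<Rightarrow> real" and t :: "'j \<Rightarrow> 'l" and T :: "'j \<Rightarrow> 'c set"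
  assumes "finite U" "finite \<Lambda>" "\<And>l. l \<in> \<Lambda> \<Longrightarrow> 0 \<le> p l" "(\<Sum>l\<in>\<Lambda>. p l) = 1"
    and "\<And>j. j \<in> J \<Longrightarrow> T j \<subseteq> U" "\<And>j. j \<in> J \<Longrightarrow> t j \<in> \<Lambda>" "\<And>j. j \<in> J \<Longrightarrow> 0 \<le> w j"
  shows "\<exists>f. (\<Sum>j\<in>J. w j * (1/2) ^ card {c \<in> T j. f c = t j})
            \<le> (\<Sum>j\<in>J. w j * exp (- p (t j) * card (T j) / 2))"
proof -
  define g where "g j l = (if l = t j then 1/2 else (1::real))" for j l
  obtain f where f: "(\<Sum>j\<in>J. w j * (\<Prod>c\<in>T j. g j (f c)))
            \<le> (\<Sum>j\<in>J. w j * (\<Sum>l\<in>\<Lambda>. p l * g j l) ^ card (T j))"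
    using exists_labelling_le_expectation[OF assms(1-4), of J T w g] assms(5) by blast
  have "(\<Prod>c\<in>T j. g j (f c)) = (1/2) ^ card {c \<in> T j. f c = t j}" if "j \<in> J" for j
  proof -
    have "finite (T j)" using assms(1) assms(5)[OF that] by (rule finite_subset[rotated])
    then have "(\<Prod>c\<in>T j. g j (f c)) = (\<Prod>c\<in>{c \<in> T j. f c = t j}. 1/2)"
      unfolding g_def by (subst prod.inter_filter) auto
    then show ?thesis by simp
  qed
  then have lhs: "(\<Sum>j\<in>J. w j * (\<Prod>c\<in>T j. g j (f c)))
      = (\<Sum>j\<in>J. w j * (1/2) ^ card {c \<in> T j. f c = t j})" by (simp cong: sum.cong)
  have "w j * (\<Sum>l\<in>\<Lambda>. p l * g j l) ^ card (T j) \<le> w j * exp (- p (t j) * card (T j) / 2)"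
    if j: "j \<in> J" for j
  proof -
    have "(\<Sum>l\<in>\<Lambda>. p l * g j l) = (\<Sum>l\<in>\<Lambda>. p l - (if l = t j then p l / 2 else 0))"
      unfolding g_def by (intro sum.cong) auto
    also have "\<dots> = 1 - p (t j) / 2"
      using assms(2,4) assms(6)[OF j] by (simp add: sum_subtractf)
    also have "\<dots> \<le> exp (- (p (t j) / 2))"
      using exp_ge_add_one_self[of "- (p (t j) / 2)"] by simp
    finally have "(\<Sum>l\<in>\<Lambda>. p l * g j l) \<le> exp (- (p (t j) / 2))" .
    moreover have "0 \<le> (\<Sum>l\<in>\<Lambda>. p l * g j l)"
      using assms(3) by (intro sum_nonneg) (auto simp: g_def)
    ultimately have "(\<Sum>l\<in>\<Lambda>. p l * g j l) ^ card (T j) \<le> exp (- (p (t j) / 2)) ^ card (T j)"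
      by (intro power_mono)
    also have "\<dots> = exp (- p (t j) * card (T j) / 2)"
      by (subst exp_of_nat_mult[symmetric]) (simp add: algebra_simps)
    finally show ?thesis using assms(7)[OF j] by (rule mult_left_mono)
  qed
  then show ?thesis using f unfolding lhs by (meson order_trans sum_mono)
qed

section \<open>Colouring from lists of size proportional to the total weight\<close>

definition weight :: "nat \<Rightarrow> ('i \<Rightarrow> 'v set) \<Rightarrow> 'i \<Rightarrow> real" where
  "weight k V i = real k + ln (real (card (V i)))"

context
  fixes k :: nat and V :: "'i \<Rightarrow> 'v set"
  assumes k: "1 \<le> k" and fin_V: "\<And>i. finite (V i)" and V_ne: "\<And>i. V i \<noteq> {}"
begin

section \<open>Exponential estimates for the weights\<close>

lemma card_class_pos: "0 < card (V i)"
  using fin_V V_ne by (simp add: card_gt_0_iff)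

lemma weight_ge_1: "1 \<le> weight k V i"
proof -
  have "0 \<le> ln (real (card (V i)))"
    using card_class_pos[of i] by (intro ln_ge_zero) simp
  then show ?thesis using k by (simp add: weight_def)
qed

text \<open>The left side is the price of a union bound over the vertices of a class, each carrying
  the factor \<open>2 ^ k\<close>. The weight is designed to pay for it, using
  \<open>2 <= exp 1\<close>.\<close>

lemma card_times_two_power_le: "real (card (V i)) * 2 ^ k \<le> exp (weight k V i)"
proof -
  have "(2::real) ^ k \<le> exp 1 ^ k"
    using exp_ge_add_one_self[of 1] by (intro power_mono) auto
  also have "\<dots> = exp (real k)" by (simp add: exp_of_nat_mult[symmetric])
  finally have "real (card (V i)) * 2 ^ k \<le> real (card (V i)) * exp (real k)"
    by (intro mult_left_mono) auto
  then show ?thesis using card_class_pos[of i] by (simp add: weight_def exp_add mult_ac)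
qed

text \<open>Bounds the expected cost of classes receiving too few colours. The exponent is half the
  expected number of hits: \<open>weight k V i / (2 * W)\<close> times \<open>100 * W\<close>,
  halved, is \<open>25 * weight k V i\<close>. The union bound uses up one weight, the remaining 24
  give a factor below 1/25, and the coefficients \<open>4 * weight k V i / W\<close> add up to
  4.\<close>

lemma weight_sum_main_le:
  assumes "finite I" "I \<noteq> {}"
  defines "W \<equiv> \<Sum>i\<in>I. weight k V i"
  shows "(\<Sum>i\<in>I. \<Sum>v\<in>V i. 4 * weight k V i / W * 2 ^ k * exp (- (25 * weight k V i))) \<le> 4 / 25"
proof -
  have W: "0 < W"
    unfolding W_def using assms(1,2) weight_ge_1
    by (intro sum_pos) (auto intro: less_le_trans[OF zero_less_one])
  have "(\<Sum>i\<in>I. \<Sum>v\<in>V i. 4 * weight k V i / W * 2 ^ k * exp (- (25 * weight k V i)))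
      \<le> (\<Sum>i\<in>I. 4 * weight k V i / W * (1 / 25))"
  proof (intro sum_mono)
    fix i
    have "real (card (V i)) * 2 ^ k * exp (- (25 * weight k V i)) \<le> exp (weight k V i) * exp (- (25 * weight k V i))"
      by (intro mult_right_mono card_times_two_power_le) auto
    also have "\<dots> = exp (- (24 * weight k V i))" by (simp add: exp_add[symmetric])
    also have "\<dots> \<le> exp (- 24)" using weight_ge_1[of i] by simp
    also have "\<dots> \<le> 1 / 25" using exp_ge_add_one_self[of 24] by (simp add: exp_minus field_simps)
    finally have "4 * weight k V i / W * (real (card (V i)) * 2 ^ k * exp (- (25 * weight k V i)))
        \<le> 4 * weight k V i / W * (1 / 25)"
      using W weight_ge_1[of i] by (intro mult_left_mono) auto
    then show "(\<Sum>v\<in>V i. 4 * weight k V i / W * 2 ^ k * exp (- (25 * weight k V i)))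
        \<le> 4 * weight k V i / W * (1 / 25)" by (simp add: mult_ac)
  qed
  also have "\<dots> = 4 / 25 * (W / W)"
    unfolding W_def sum_divide_distrib sum_distrib_left by (intro sum.cong) auto
  finally show ?thesis using W by simp
qed

text \<open>Bounds the expected cost of lists keeping too few reserved colours. Probability 1/2 on
  \<open>100 * W\<close> colours gives the exponent \<open>25 * W\<close>, and the factor
  \<open>exp (25 * W * ln 2)\<close> is 2 to the power \<open>25 * W\<close>. There are at most
  \<open>exp (2 * W)\<close> vertices, since both the number of classes and each class size are at
  most \<open>exp W\<close>.\<close>

lemma weight_sum_reserve_le:
  assumes "finite I" "I \<noteq> {}"
  defines "W \<equiv> \<Sum>i\<in>I. weight k V i"
  shows "(\<Sum>i\<in>I. \<Sum>v\<in>V i. exp (25 * W * ln 2) * exp (- (25 * W))) \<le> 1 / 4"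
proof -
  have cW: "real (card I) \<le> W"
    unfolding W_def using sum_mono[of I "\<lambda>_. 1" "weight k V"] weight_ge_1 by simp
  moreover have "1 \<le> card I" using assms(1,2) by (simp add: Suc_le_eq card_gt_0_iff)
  ultimately have W1: "1 \<le> W" by linarith
  have "real (card (V i)) \<le> exp W" if "i \<in> I" for i
  proof -
    have "real (card (V i)) \<le> real (card (V i)) * 2 ^ k"
      using mult_left_mono[of 1 "2 ^ k" "real (card (V i))"] by simp
    also have "\<dots> \<le> exp (weight k V i)" by (rule card_times_two_power_le)
    also have "weight k V i \<le> W"
      unfolding W_def using assms(1) that weight_ge_1
      by (intro member_le_sum) (auto intro: order_trans[OF zero_le_one])
    finally show ?thesis by simp
  qed
  then have "(\<Sum>i\<in>I. real (card (V i))) \<le> real (card I) * exp W"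
    by (rule sum_bounded_above)
  also have "\<dots> \<le> exp W * exp W"
    using cW exp_ge_add_one_self[of W] by (intro mult_right_mono) linarith+
  finally have c: "(\<Sum>i\<in>I. real (card (V i))) \<le> exp (2 * W)" by (simp add: exp_add[symmetric])
  have "(\<Sum>i\<in>I. \<Sum>v\<in>V i. exp (25 * W * ln 2) * exp (- (25 * W)))
      = (\<Sum>i\<in>I. real (card (V i))) * exp (25 * W * ln 2 - 25 * W)"
    by (simp add: sum_distrib_right exp_add[symmetric])
  also have "\<dots> \<le> exp (2 * W) * exp (25 * W * ln 2 - 25 * W)"
    by (intro mult_right_mono c) auto
  also have "\<dots> = exp (W * (25 * ln 2 - 23))"
    by (simp add: exp_add[symmetric] algebra_simps)
  also have "\<dots> \<le> exp (- 3)"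
  proof -
    \<comment> \<open>The quadratic Taylor bound at 4/5 is 53/25, above 2. Then
      \<open>25 * ln 2 <= 20\<close>, which turns the coefficient of \<open>W\<close> into at most
      -3.\<close>
    have "2 \<le> exp (4 / 5 :: real)"
      using exp_lower_Taylor_quadratic[of "4 / 5"] by (simp add: power2_eq_square)
    then have "ln 2 \<le> (4 / 5 :: real)" using ln_le_cancel_iff[of 2 "exp (4 / 5)"] by simp
    then have "W * (25 * ln 2 - 23) \<le> W * (-3)" using W1 by (intro mult_left_mono) auto
    also have "\<dots> \<le> -3" using W1 by simp
    finally show ?thesis by simp
  qed
  also have "\<dots> \<le> 1 / 4" using exp_ge_add_one_self[of 3] by (simp add: exp_minus field_simps)
  finally show ?thesis .
qed

section \<open>One round of random labelling\<close>

text \<open>Both requirements are coded into a single weighted sum whose expectation is below 1.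
  Some labelling keeps that sum below 1, and since its two halves are nonnegative, each of them is
  below 1 for the same labelling.\<close>

lemma exists_good_labelling:
  fixes S :: "'i \<Rightarrow> 'v \<Rightarrow> 'c set"
  assumes "finite I" "I \<noteq> {}"
    and fin_S: "\<And>i v. i \<in> I \<Longrightarrow> v \<in> V i \<Longrightarrow> finite (S i v)"
    and card_S: "\<And>i v. i \<in> I \<Longrightarrow> v \<in> V i \<Longrightarrow> 100 * (\<Sum>i\<in>I. weight k V i) \<le> card (S i v)"
  defines "W \<equiv> \<Sum>i\<in>I. weight k V i"
  shows "\<exists>f :: 'c \<Rightarrow> 'i option.
    (\<forall>i\<in>I. \<forall>v\<in>V i. 25 * W \<le> card {c \<in> S i v. f c = None}) \<and>
    4 * (\<Sum>i\<in>{i \<in> I. \<exists>v\<in>V i. card {c \<in> S i v. f c = Some i} < k}. weight k V i) < W"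
proof -
  have W: "0 < W"
    unfolding W_def using assms(1,2) weight_ge_1
    by (intro sum_pos) (auto intro: less_le_trans[OF zero_less_one])
  define U where "U = (\<Union>i\<in>I. \<Union>v\<in>V i. S i v)"
  define \<Lambda> where "\<Lambda> = insert None (Some ` I)"
  define p where "p l = (case l of None \<Rightarrow> 1/2 | Some i \<Rightarrow> weight k V i / (2 * W))" for l :: "'i option"
  \<comment> \<open>Each vertex is tested twice: \<open>True\<close> counts the colours given to its
    own class, \<open>False\<close> the reserved ones.\<close>
  define J where "J = Sigma I V \<times> (UNIV :: bool set)"
  define T where "T = (\<lambda>((i, v), b :: bool). S i v)"
  define t where "t = (\<lambda>((i :: 'i, v :: 'v), b). if b then Some i else None)"
  \<comment> \<open>With these weights a vertex with at most \<open>k\<close> colours of its class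
    costs at least \<open>4 * weight k V i / W\<close>, and a list with at most
    \<open>25 * W\<close> reserved colours costs at least 1. The second weight is written with
    \<open>exp\<close> because \<open>25 * W\<close> need not be an integer.\<close>
  define w where "w = (\<lambda>((i :: 'i, v :: 'v), b). if b then 4 * weight k V i / W * 2 ^ k else exp (25 * W * ln 2))"
  have split_J: "(\<Sum>j\<in>J. h j) = (\<Sum>i\<in>I. \<Sum>v\<in>V i. h ((i, v), True)) + (\<Sum>i\<in>I. \<Sum>v\<in>V i. h ((i, v), False))"
    for h :: "('i \<times> 'v) \<times> bool \<Rightarrow> real"
  proof -
    have "(\<Sum>j\<in>J. h j) = (\<Sum>x\<in>Sigma I V. \<Sum>b\<in>UNIV. h (x, b))"
      unfolding J_def by (simp add: sum.cartesian_product)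
    also have "\<dots> = (\<Sum>i\<in>I. \<Sum>v\<in>V i. \<Sum>b\<in>UNIV. h ((i, v), b))"
      using assms(1) fin_V by (subst sum.Sigma) (auto simp: case_prod_unfold)
    finally show ?thesis by (simp add: UNIV_bool sum.distrib add.commute)
  qed
  have "(\<Sum>l\<in>\<Lambda>. p l) = 1/2 + (\<Sum>i\<in>I. weight k V i / (2 * W))"
    using assms(1) unfolding \<Lambda>_def p_def by (simp add: sum.reindex)
  also have "\<dots> = 1" using W by (simp add: sum_divide_distrib[symmetric] W_def[symmetric])
  finally have "(\<Sum>l\<in>\<Lambda>. p l) = 1" .
  moreover have "finite U" using assms(1) fin_V fin_S unfolding U_def by auto
  moreover have "0 \<le> weight k V i" for i using weight_ge_1[of i] by simp
  ultimately obtain f where f: "(\<Sum>j\<in>J. w j * (1/2) ^ card {c \<in> T j. f c = t j})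
        \<le> (\<Sum>j\<in>J. w j * exp (- p (t j) * card (T j) / 2))"
    using exists_labelling_few_hits_bound[of U \<Lambda> p J T t w] W assms(1)
    by (force simp: \<Lambda>_def p_def J_def T_def t_def w_def U_def split: option.splits)
  have "(\<Sum>j\<in>J. w j * exp (- p (t j) * card (T j) / 2))
      \<le> (\<Sum>i\<in>I. \<Sum>v\<in>V i. 4 * weight k V i / W * 2 ^ k * exp (- (25 * weight k V i)))
        + (\<Sum>i\<in>I. \<Sum>v\<in>V i. exp (25 * W * ln 2) * exp (- (25 * W)))"
    unfolding split_J
  proof (intro add_mono sum_mono)
    fix i v assume iv: "i \<in> I" "v \<in> V i"
    have "100 * W \<le> card (S i v)" using card_S[OF iv] by (simp add: W_def)
    then have "weight k V i / W * (100 * W) \<le> weight k V i / W * card (S i v)"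
      using W weight_ge_1[of i] by (intro mult_left_mono) auto
    then have "- p (Some i) * card (S i v) / 2 \<le> - (25 * weight k V i)"
      using W by (simp add: p_def field_simps)
    then show "w ((i, v), True) * exp (- p (t ((i, v), True)) * card (T ((i, v), True)) / 2)
        \<le> 4 * weight k V i / W * 2 ^ k * exp (- (25 * weight k V i))"
      using W weight_ge_1[of i] by (auto simp: w_def t_def T_def intro!: mult_left_mono divide_right_mono)
    show "w ((i, v), False) * exp (- p (t ((i, v), False)) * card (T ((i, v), False)) / 2)
        \<le> exp (25 * W * ln 2) * exp (- (25 * W))"
      using card_S[OF iv] by (simp add: w_def p_def t_def T_def W_def)
  qed
  also have "\<dots> \<le> 4 / 25 + 1 / 4"
    unfolding W_def using weight_sum_main_le[OF assms(1,2)] weight_sum_reserve_le[OF assms(1,2)]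
    by (rule add_mono)
  also have "\<dots> < 1" by simp
  finally have lt1: "(\<Sum>i\<in>I. \<Sum>v\<in>V i. 4 * weight k V i / W * 2 ^ k * (1/2) ^ card {c \<in> S i v. f c = Some i})
      + (\<Sum>i\<in>I. \<Sum>v\<in>V i. exp (25 * W * ln 2) * (1/2) ^ card {c \<in> S i v. f c = None}) < 1"
    (is "?main + ?res < 1")
    using f unfolding split_J by (simp add: w_def t_def T_def)
  have main_nonneg: "0 \<le> 4 * weight k V i / W * 2 ^ k * (1/2) ^ n" for i n
    using W weight_ge_1[of i] by simp
  have "0 \<le> ?main" by (intro sum_nonneg main_nonneg)
  moreover have "0 \<le> ?res" by (intro sum_nonneg) auto
  ultimately have main: "?main < 1" and res: "?res < 1" using lt1 by linarith+
  define B where "B = {i \<in> I. \<exists>v\<in>V i. card {c \<in> S i v. f c = Some i} < k}"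
  have "25 * W \<le> card {c \<in> S i v. f c = None}" if iv: "i \<in> I" "v \<in> V i" for i v
  proof -
    define n where "n = card {c \<in> S i v. f c = None}"
    have "exp (25 * W * ln 2) * (1/2) ^ n
        \<le> (\<Sum>v\<in>V i. exp (25 * W * ln 2) * (1/2) ^ card {c \<in> S i v. f c = None})"
      unfolding n_def using iv fin_V by (intro member_le_sum) auto
    also have "\<dots> \<le> ?res"
      using iv assms(1) fin_V
      by (intro member_le_sum[of i I "\<lambda>i. \<Sum>v\<in>V i. exp (25 * W * ln 2) * (1/2) ^ card {c \<in> S i v. f c = None}"])
        (auto intro!: sum_nonneg)
    also have "?res < 1" by (rule res)
    finally have "exp (25 * W * ln 2) < 2 ^ n" by (simp add: power_one_over field_simps)
    also have "(2::real) ^ n = exp (real n * ln 2)" by (simp add: exp_of_nat_mult)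
    finally show ?thesis unfolding n_def by simp
  qed
  moreover have "4 * (\<Sum>i\<in>B. weight k V i) < W"
  proof -
    \<comment> \<open>Markov's inequality: one failing vertex already makes its class contribute
      \<open>4 * weight k V i / W\<close> to the first sum, which is below 1.\<close>
    have "(\<Sum>i\<in>B. 4 * weight k V i / W)
        \<le> (\<Sum>i\<in>B. \<Sum>v\<in>V i. 4 * weight k V i / W * 2 ^ k * (1/2) ^ card {c \<in> S i v. f c = Some i})"
    proof (intro sum_mono)
      fix i assume "i \<in> B"
      then obtain v where v: "v \<in> V i" "card {c \<in> S i v. f c = Some i} \<le> k"
        unfolding B_def by auto
      have "(1::real) = 2 ^ k * (1/2) ^ k" by (simp add: power_mult_distrib[symmetric])
      also have "\<dots> \<le> 2 ^ k * (1/2) ^ card {c \<in> S i v. f c = Some i}"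
        using v(2) by (intro mult_left_mono power_decreasing) auto
      finally have "4 * weight k V i / W * 1
          \<le> 4 * weight k V i / W * (2 ^ k * (1/2) ^ card {c \<in> S i v. f c = Some i})"
        using W weight_ge_1[of i] by (intro mult_left_mono) auto
      also have "\<dots> \<le> (\<Sum>v\<in>V i. 4 * weight k V i / W * 2 ^ k * (1/2) ^ card {c \<in> S i v. f c = Some i})"
        using member_le_sum[of v "V i" "\<lambda>v. 4 * weight k V i / W * 2 ^ k * (1/2) ^ card {c \<in> S i v. f c = Some i}"]
          v(1) fin_V main_nonneg by (simp add: mult.assoc)
      finally show "4 * weight k V i / W
          \<le> (\<Sum>v\<in>V i. 4 * weight k V i / W * 2 ^ k * (1/2) ^ card {c \<in> S i v. f c = Some i})" by simp
    qed
    also have "\<dots> \<le> ?main"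
      using assms(1) main_nonneg by (intro sum_mono2) (auto simp: B_def intro!: sum_nonneg)
    also have "\<dots> < 1" by (rule main)
    finally show ?thesis using W by (simp add: sum_divide_distrib[symmetric] sum_distrib_left[symmetric])
  qed
  ultimately show ?thesis unfolding B_def by blast
qed

section \<open>Induction on the set of classes\<close>

text \<open>The lists are only bounded from below, and \<open>S\<close> is generalised, because the
  recursive call replaces each list by its reserved part, whose size varies with the vertex. The
  ratio 100 to 1 between list size and total weight survives the round: the lists shrink at most to
  \<open>25 * W\<close> while the weight drops below \<open>W / 4\<close>.\<close>

lemma exists_multipartite_list_colouring:
  fixes S :: "'i \<Rightarrow> 'v \<Rightarrow> 'c set"
  assumes "finite I"
    and "\<And>i v. i \<in> I \<Longrightarrow> v \<in> V i \<Longrightarrow> finite (S i v)"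
    and "\<And>i v. i \<in> I \<Longrightarrow> v \<in> V i \<Longrightarrow> 100 * (\<Sum>i\<in>I. weight k V i) \<le> card (S i v)"
  shows "\<exists>C. (\<forall>i\<in>I. \<forall>v\<in>V i. C i v \<subseteq> S i v \<and> card (C i v) = k) \<and>
    (\<forall>i\<in>I. \<forall>j\<in>I. i \<noteq> j \<longrightarrow> (\<forall>u\<in>V i. \<forall>v\<in>V j. C i u \<inter> C j v = {}))"
  using assms
proof (induction I arbitrary: S rule: finite_psubset_induct)
  case (psubset I)
  show ?case
  proof (cases "I = {}")
    case False
    define W where "W = (\<Sum>i\<in>I. weight k V i)"
    obtain f :: "'c \<Rightarrow> 'i option" where
      reserve: "\<And>i v. i \<in> I \<Longrightarrow> v \<in> V i \<Longrightarrow> 25 * W \<le> card {c \<in> S i v. f c = None}" and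
      bad: "4 * (\<Sum>i\<in>{i \<in> I. \<exists>v\<in>V i. card {c \<in> S i v. f c = Some i} < k}. weight k V i) < W"
      using exists_good_labelling[where S = S, OF psubset.hyps(1) False] psubset.prems unfolding W_def by blast
    define B where "B = {i \<in> I. \<exists>v\<in>V i. card {c \<in> S i v. f c = Some i} < k}"
    have B_W: "4 * (\<Sum>i\<in>B. weight k V i) < W" using bad unfolding B_def .
    have nonneg: "0 \<le> weight k V i" for i using weight_ge_1[of i] by simp
    have "0 \<le> (\<Sum>i\<in>B. weight k V i)" by (intro sum_nonneg nonneg)
    \<comment> \<open>If \<open>B = I\<close>, the bound would read \<open>4 * W < W\<close>,
      contradicting \<open>0 <= W\<close>; so the recursion is on a proper subset.\<close>
    then have "B \<noteq> I" using B_W unfolding W_def by auto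
    then have "B \<subset> I" unfolding B_def by blast
    have "\<exists>D. (\<forall>i\<in>B. \<forall>v\<in>V i. D i v \<subseteq> {c \<in> S i v. f c = None} \<and> card (D i v) = k) \<and>
        (\<forall>i\<in>B. \<forall>j\<in>B. i \<noteq> j \<longrightarrow> (\<forall>u\<in>V i. \<forall>v\<in>V j. D i u \<inter> D j v = {}))"
    proof (rule psubset.IH[OF \<open>B \<subset> I\<close>])
      fix i v assume iv: "i \<in> B" "v \<in> V i"
      then have "i \<in> I" using \<open>B \<subset> I\<close> by auto
      show "finite {c \<in> S i v. f c = None}" using psubset.prems(1)[OF \<open>i \<in> I\<close> iv(2)] by simp
      show "100 * (\<Sum>i\<in>B. weight k V i) \<le> card {c \<in> S i v. f c = None}"
        using B_W reserve[OF \<open>i \<in> I\<close> iv(2)] by linarith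
    qed
    then obtain D where
      D: "\<forall>i\<in>B. \<forall>v\<in>V i. D i v \<subseteq> {c \<in> S i v. f c = None} \<and> card (D i v) = k" and
      D_disj: "\<forall>i\<in>B. \<forall>j\<in>B. i \<noteq> j \<longrightarrow> (\<forall>u\<in>V i. \<forall>v\<in>V j. D i u \<inter> D j v = {})"
      by (elim exE conjE)
    have "\<exists>E. E \<subseteq> {c \<in> S i v. f c = Some i} \<and> card E = k" if "i \<in> I - B" "v \<in> V i" for i v
    proof -
      have "k \<le> card {c \<in> S i v. f c = Some i}" using that unfolding B_def by auto
      then show ?thesis by (metis obtain_subset_with_card_n)
    qed
    then obtain E where
      E: "\<And>i v. i \<in> I - B \<Longrightarrow> v \<in> V i \<Longrightarrow> E i v \<subseteq> {c \<in> S i v. f c = Some i} \<and> card (E i v) = k"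
      by metis
    define C where "C i v = (if i \<in> B then D i v else E i v)" for i v
    have C: "C i v \<subseteq> {c \<in> S i v. f c = (if i \<in> B then None else Some i)} \<and> card (C i v) = k"
      if "i \<in> I" "v \<in> V i" for i v
      using that bspec[OF bspec[OF D, of i], of v] E[of i v] unfolding C_def by auto
    have "C i u \<inter> C j v = {}" if "i \<in> I" "j \<in> I" "i \<noteq> j" "u \<in> V i" "v \<in> V j" for i j u v
    proof (cases "i \<in> B \<and> j \<in> B")
      case True
      then show ?thesis using D_disj that by (simp add: C_def)
    next
      case False
      \<comment> \<open>The label of a colour tells who may use it: classes in \<open>B\<close> use
        only \<open>None\<close>, any other class only its own \<open>Some i\<close>. Two distinct
        classes share a label only if both lie in \<open>B\<close>, where the induction hypothesis
        separates them.\<close>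
      then have "(if i \<in> B then None else Some i) \<noteq> (if j \<in> B then None else Some j)"
        using that(3) by auto
      moreover have "f c = (if i \<in> B then None else Some i)" if "c \<in> C i u" for c
        using C[OF \<open>i \<in> I\<close> \<open>u \<in> V i\<close>] that by auto
      moreover have "f c = (if j \<in> B then None else Some j)" if "c \<in> C j v" for c
        using C[OF \<open>j \<in> I\<close> \<open>v \<in> V j\<close>] that by auto
      ultimately show ?thesis by (metis disjoint_iff)
    qed
    moreover have "C i v \<subseteq> S i v \<and> card (C i v) = k" if "i \<in> I" "v \<in> V i" for i v
      using C[OF that] by auto
    ultimately show ?thesis by (intro exI[of _ C]) simp
  qed auto
qed

end

section \<open>The choice number\<close>

lemma choosable_complete_multipartite:
  assumes "1 \<le> k" "\<And>i. 1 \<le> i \<Longrightarrow> i \<le> r \<Longrightarrow> 1 \<le> m i"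
    and "100 * (\<Sum>i=1..r. real k + ln (real (m i))) \<le> real n"
  shows "choosable (complete_multipartite r m) n k"
  unfolding choosable_def
proof (intro allI impI)
  fix S :: "nat \<times> nat \<Rightarrow> nat set"
  assume S: "\<forall>v\<in>verts (complete_multipartite r m). finite (S v) \<and> card (S v) = n"
  \<comment> \<open>The preceding results ask for a finite nonempty class at every index, so indices
    outside \<open>{1..r}\<close> get the dummy class \<open>{0}\<close>.\<close>
  define V where "V i = (if i \<in> {1..r} then {..<m i} else {0})" for i
  have V: "finite (V i)" "V i \<noteq> {}" for i
    using assms(2)[of i] by (auto simp: V_def lessThan_empty_iff)
  have verts: "verts (complete_multipartite r m) = Sigma {1..r} V"
    by (auto simp: complete_multipartite_def Let_def V_def)
  have "100 * (\<Sum>i=1..r. weight k V i) = 100 * (\<Sum>i=1..r. real k + ln (real (m i)))"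
    by (simp add: weight_def V_def)
  then have "\<exists>C. (\<forall>i\<in>{1..r}. \<forall>v\<in>V i. C i v \<subseteq> S (i, v) \<and> card (C i v) = k) \<and>
    (\<forall>i\<in>{1..r}. \<forall>j\<in>{1..r}. i \<noteq> j \<longrightarrow> (\<forall>u\<in>V i. \<forall>v\<in>V j. C i u \<inter> C j v = {}))"
    using S assms(3) unfolding verts
    by (intro exists_multipartite_list_colouring[OF assms(1) V]) auto
  then obtain C where
    C: "\<And>i v. i \<in> {1..r} \<Longrightarrow> v \<in> V i \<Longrightarrow> C i v \<subseteq> S (i, v) \<and> card (C i v) = k" and
    disj: "\<And>i j u v. i \<in> {1..r} \<Longrightarrow> j \<in> {1..r} \<Longrightarrow> i \<noteq> j \<Longrightarrow> u \<in> V i \<Longrightarrow> v \<in> V j \<Longrightarrow> C i u \<inter> C j v = {}"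
    by metis
  have edge: "fst u \<noteq> fst v" if "{u, v} \<in> edges (complete_multipartite r m)" for u v
    using that by (auto simp: complete_multipartite_def Let_def doubleton_eq_iff)
  show "\<exists>C. (\<forall>v\<in>verts (complete_multipartite r m). C v \<subseteq> S v \<and> card (C v) = k) \<and>
      (\<forall>u\<in>verts (complete_multipartite r m). \<forall>v\<in>verts (complete_multipartite r m).
         {u, v} \<in> edges (complete_multipartite r m) \<longrightarrow> C u \<inter> C v = {})"
  proof (intro exI[of _ "\<lambda>v. C (fst v) (snd v)"] conjI ballI impI)
    fix u v
    assume "u \<in> verts (complete_multipartite r m)" "v \<in> verts (complete_multipartite r m)"
      and "{u, v} \<in> edges (complete_multipartite r m)"
    then show "C (fst u) (snd u) \<inter> C (fst v) (snd v) = {}"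
      using edge unfolding verts by (intro disj) auto
  next
    fix v assume "v \<in> verts (complete_multipartite r m)"
    then show "C (fst v) (snd v) \<subseteq> S v" "card (C (fst v) (snd v)) = k"
      using C[of "fst v" "snd v"] unfolding verts by auto
  qed
qed

text \<open>Jensen's inequality for the logarithm, from its tangent at the average \<open>a\<close>:
  \<open>ln y <= y - 1\<close> is applied to \<open>y = x i / a\<close>, and the right-hand sides
  sum to 0.\<close>

lemma sum_ln_le_ln_average:
  fixes x :: "'a \<Rightarrow> real"
  assumes "finite A" "A \<noteq> {}" "\<And>i. i \<in> A \<Longrightarrow> 0 < x i"
  shows "(\<Sum>i\<in>A. ln (x i)) \<le> card A * ln ((\<Sum>i\<in>A. x i) / card A)"
proof -
  define a where "a = (\<Sum>i\<in>A. x i) / card A"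
  have card: "0 < real (card A)" using assms(1,2) by (simp add: card_gt_0_iff)
  have a: "0 < a" unfolding a_def using assms card by (intro divide_pos_pos sum_pos)
  have "ln (x i) - ln a \<le> x i / a - 1" if "i \<in> A" for i
    using ln_le_minus_one[of "x i / a"] a assms(3)[OF that] by (simp add: ln_div)
  then have "(\<Sum>i\<in>A. ln (x i) - ln a) \<le> (\<Sum>i\<in>A. x i / a - 1)" by (rule sum_mono)
  also have "\<dots> = (\<Sum>i\<in>A. x i) / a - card A" by (simp add: sum_subtractf sum_divide_distrib)
  also have "\<dots> = 0" using a card unfolding a_def by (auto simp: field_simps)
  finally show ?thesis by (simp add: sum_subtractf a_def)
qed

theorem theorem3p1:
  fixes r :: nat and m :: "nat \<Rightarrow> nat" and k :: nat
  assumes "r \<ge> 1"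
    and "\<And>i. 1 \<le> i \<Longrightarrow> i \<le> r \<Longrightarrow> m i \<ge> 2"
    and "k \<ge> 1"
  shows "real (choice_number k (complete_multipartite r m))
    \<le> 948 * real r * (real k + ln (real (\<Sum>i = 1..r. m i) / real r))"
proof -
  define W where "W = (\<Sum>i=1..r. real k + ln (real (m i)))"
  define n where "n = nat \<lceil>100 * W\<rceil>"
  have m1: "1 \<le> m i" if "1 \<le> i" "i \<le> r" for i using assms(2)[OF that] by simp
  have term1: "1 \<le> real k + ln (real (m i))" if "i \<in> {1..r}" for i
  proof -
    have "0 \<le> ln (real (m i))" using m1[of i] that by (intro ln_ge_zero) auto
    then show ?thesis using assms(3) by linarith
  qed
  then have "(\<Sum>i=1..r. 1) \<le> W" unfolding W_def by (rule sum_mono)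
  then have W1: "1 \<le> W" using assms(1) by simp
  have "choosable (complete_multipartite r m) n k"
    using assms(3) m1 real_nat_ceiling_ge[of "100 * W"]
    by (intro choosable_complete_multipartite) (auto simp: n_def W_def)
  then have "choice_number k (complete_multipartite r m) \<le> n"
    unfolding choice_number_def by (rule Least_le)
  then have "real (choice_number k (complete_multipartite r m)) \<le> real n" by simp
  also have "real n \<le> 100 * W + 1" unfolding n_def using W1 by linarith
  \<comment> \<open>Since \<open>1 <= W\<close>, the 1 lost in rounding up is absorbed; already
    \<open>101 * W\<close> would bound the left side.\<close>
  also have "\<dots> \<le> 948 * W" using W1 by simp
  also have "W \<le> real r * (real k + ln (real (\<Sum>i = 1..r. m i) / real r))"
    using sum_ln_le_ln_average[of "{1..r}" "\<lambda>i. real (m i)"] assms(1) m1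
    by (force simp: W_def sum.distrib algebra_simps)
  finally show ?thesis by simp
qed

end
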